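(* Let $R$ be a minimal rotational surface in $\mathbb{E}^3$ and $\alpha$ be a loxodrome on $R$. Then the parametrization of $\alpha$ is given by $$\alpha(t)=\begin{pmatrix}\frac1n\sqrt{1+n^2(at+p)^2}\,\cos\big(\tan\psi\,\operatorname{arcsinh}(n(at+p))+q\big)\\ \frac1n\sqrt{1+n^2(at+p)^2}\,\sin\big(\tan\psi\,\operatorname{arcsinh}(n(at+p))+q\big)\\ \frac1n\operatorname{arcsinh}(n(at+p))+r\end{pmatrix}$$ for constants $n,p,q,r$ and $a=\cos\psi$.
   Context: A rotational surface $R$ is given by an immersion $\Phi(s,\theta)=(f(s)\cos\theta,f(s)\sin\theta,g(s))$ with $f'^2+g'^2=1$. $R$ is minimal if its mean curvature (half the sum of the principal curvatures) is zero. Meridians are the curves $s\mapsto\Phi(s,\theta)$ with $\theta$ constant. A loxodrome on $R$ is a curve $\alpha(t)=\Phi(s(t),\theta(t))$, parametrized by arc length $t$, which meets the meridians at a constant angle $\psi\in[0,\pi]$.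
   Formalization: Planes (g constant), where the formula fails, and ψ = π/2, where tan ψ is undefined, are excluded; the arcsinh term of the third coordinate carries a sign ε = sgn g', since the formula as given fails for meridians oriented downwards. *)

theory Defs
  imports "HOL-Analysis.Analysis"
begin

section \<open>Parametrized surfaces in Euclidean 3-space\<close>

definition immersion_on :: "(real \<times> real \<Rightarrow> real^3) \<Rightarrow> (real \<times> real) set \<Rightarrow> bool" where
  "immersion_on X U \<longleftrightarrow> (\<forall>p\<in>U. \<exists>D. (X has_derivative D) (at p) \<and> inj D)"

definition gauss_map :: "(real \<times> real \<Rightarrow> real^3) \<Rightarrow> real \<times> real \<Rightarrow> real^3" where
  "gauss_map X p =
     sgn (cross3 (frechet_derivative X (at p) (1, 0)) (frechet_derivative X (at p) (0, 1)))"

text \<open>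
  Principal curvatures are the eigenvalues of the shape operator, which sends \<open>dX v\<close> to
  \<open>- dN v\<close> where \<open>N\<close> is the Gauss map. They are listed with multiplicity, hence the two
  linearly independent eigenvectors. Tangent vectors are given by their coordinates in the
  parameter plane.
\<close>

definition principal_curvatures ::
    "(real \<times> real \<Rightarrow> real^3) \<Rightarrow> real \<times> real \<Rightarrow> real \<Rightarrow> real \<Rightarrow> bool" where
  "principal_curvatures X p k1 k2 \<longleftrightarrow>
     (\<exists>v w. v \<noteq> w \<and> independent {v, w} \<and>
        - frechet_derivative (gauss_map X) (at p) v = k1 *\<^sub>R frechet_derivative X (at p) v \<and>
        - frechet_derivative (gauss_map X) (at p) w = k2 *\<^sub>R frechet_derivative X (at p) w)"

definition mean_curvature :: "(real \<times> real \<Rightarrow> real^3) \<Rightarrow> real \<times> real \<Rightarrow> real" where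
  "mean_curvature X p = (THE H. \<exists>k1 k2. principal_curvatures X p k1 k2 \<and> H = (k1 + k2) / 2)"

definition minimal_on :: "(real \<times> real \<Rightarrow> real^3) \<Rightarrow> (real \<times> real) set \<Rightarrow> bool" where
  "minimal_on X U \<longleftrightarrow> (\<forall>p\<in>U. mean_curvature X p = 0)"

section \<open>Rotational surfaces and loxodromes\<close>

definition rot :: "(real \<Rightarrow> real) \<Rightarrow> (real \<Rightarrow> real) \<Rightarrow> real \<times> real \<Rightarrow> real^3" where
  "rot f g = (\<lambda>(s, \<theta>). vector [f s * cos \<theta>, f s * sin \<theta>, g s])"

text \<open>
  The profile curve is of class \<open>C\<^sup>2\<close>. The sign of \<open>f\<close> is not fixed; the immersion condition
  only says that \<open>f\<close> has no zero.
\<close>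

definition rotational_surface :: "real set \<Rightarrow> (real \<Rightarrow> real) \<Rightarrow> (real \<Rightarrow> real) \<Rightarrow> bool" where
  "rotational_surface I f g \<longleftrightarrow>
     open I \<and> is_interval I \<and>
     f C1_differentiable_on I \<and> deriv f C1_differentiable_on I \<and>
     g C1_differentiable_on I \<and> deriv g C1_differentiable_on I \<and>
     (\<forall>s\<in>I. (deriv f s)\<^sup>2 + (deriv g s)\<^sup>2 = 1) \<and>
     immersion_on (rot f g) (I \<times> UNIV)"

definition vec_angle :: "'a::real_inner \<Rightarrow> 'a \<Rightarrow> real" where
  "vec_angle u v = arccos ((u \<bullet> v) / (norm u * norm v))"

text \<open>
  Meridians are oriented by increasing \<open>s\<close>, and the angle is taken between velocity vectors.
\<close>

definition loxodrome ::
    "real set \<Rightarrow> (real \<Rightarrow> real) \<Rightarrow> (real \<Rightarrow> real) \<Rightarrow> real \<Rightarrow> real set \<Rightarrow> (real \<Rightarrow> real^3) \<Rightarrow> bool" where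
  "loxodrome I f g \<psi> J \<alpha> \<longleftrightarrow>
     0 \<le> \<psi> \<and> \<psi> \<le> pi \<and> open J \<and> is_interval J \<and>
     (\<exists>s \<theta>. s C1_differentiable_on J \<and> \<theta> C1_differentiable_on J \<and>
        (\<forall>t\<in>J. s t \<in> I \<and> \<alpha> t = rot f g (s t, \<theta> t) \<and>
           norm (vector_derivative \<alpha> (at t)) = 1 \<and>
           vec_angle (vector_derivative \<alpha> (at t))
                     (vector_derivative (\<lambda>u. rot f g (u, \<theta> t)) (at (s t))) = \<psi>))"

end

theory Submission
  imports Defs
begin

text \<open>
  The shape operator of a rotational surface is diagonal in the coordinates \<open>(s, \<theta>)\<close>, so minimality
  is an ODE for the profile curve. Together with \<open>f'\<^sup>2 + g'\<^sup>2 = 1\<close> it integrates to \<open>f g' = c\<close> and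
  \<open>f f' = s + b\<close>, hence \<open>f\<^sup>2 = (s + b)\<^sup>2 + c\<^sup>2\<close>: the surface is a plane (\<open>c = 0\<close>) or a catenoid. On
  a loxodrome the angle condition reads \<open>s' = cos \<psi>\<close>, and unit speed then gives
  \<open>f \<theta>' = \<plusminus> sin \<psi>\<close> with a sign that is constant by continuity. Integrating \<open>\<theta>'\<close> gives the claim.
\<close>

section \<open>Differential of a rotational parametrization\<close>

lemma has_derivative_vector_3:
  fixes a b c :: "'a::real_normed_vector \<Rightarrow> real"
  assumes "(a has_derivative a') F" "(b has_derivative b') F" "(c has_derivative c') F"
  shows "((\<lambda>x. vector [a x, b x, c x] :: real^3) has_derivative
          (\<lambda>h. vector [a' h, b' h, c' h])) F"
proof -
  have eq: "vector [x, y, z] = x *\<^sub>R axis 1 1 + y *\<^sub>R axis 2 1 + z *\<^sub>R (axis 3 1 :: real^3)"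
    for x y z :: real
    by (simp add: vec_eq_iff forall_3 axis_def)
  show ?thesis
    unfolding eq by (intro has_derivative_add has_derivative_scaleR_left assms)
qed

text \<open>The profile functions are arbitrary because the formula serves twice: for the surface
  itself, and for its Gauss map, which is up to sign the rotational map with profile
  \<open>(- g', f')\<close>.\<close>

lemma has_derivative_rot:
  assumes u: "(u has_real_derivative u') (at s)" and w: "(w has_real_derivative w') (at s)"
  shows "(rot u w has_derivative
      (\<lambda>(h, k). vector [u' * h * cos \<theta> - u s * sin \<theta> * k, u' * h * sin \<theta> + u s * cos \<theta> * k, w' * h]))
    (at (s, \<theta>))"
proof -
  have u_fst: "((\<lambda>p. u (fst p)) has_derivative (\<lambda>p. u' * fst p)) (at (s, \<theta>))"
    and w_fst: "((\<lambda>p. w (fst p)) has_derivative (\<lambda>p. w' * fst p)) (at (s, \<theta>))"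
    using u w
    by (auto intro!: has_derivative_compose[of fst fst, OF has_derivative_fst[OF has_derivative_ident]]
        simp: has_field_derivative_def)
  show ?thesis
    unfolding rot_def case_prod_beta
    by (rule has_derivative_eq_rhs, rule has_derivative_vector_3,
        (rule derivative_intros u_fst w_fst)+) (auto simp: fun_eq_iff algebra_simps)
qed

text \<open>On the axis of rotation the differential kills the direction \<open>(0, 1)\<close> of
  the parallels, against injectivity.\<close>

lemma immersion_rot_nonzero:
  assumes "immersion_on (rot f g) (I \<times> UNIV)" "s \<in> I"
    and "(f has_real_derivative f') (at s)" "(g has_real_derivative g') (at s)"
  shows "f s \<noteq> 0"
proof
  assume 0: "f s = 0"
  obtain D where D: "(rot f g has_derivative D) (at (s, 0))" "inj D"
    using assms(1,2) by (auto simp: immersion_on_def)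
  have "D = (\<lambda>(h, k). vector [f' * h * cos 0 - f s * sin 0 * k, f' * h * sin 0 + f s * cos 0 * k, g' * h])"
    by (rule has_derivative_unique[OF D(1) has_derivative_rot[OF assms(3,4)]])
  hence "D (0, 1) = D (0, 0)" by (simp add: 0)
  thus False using D(2) by (auto dest: injD)
qed

section \<open>Mean curvature from a diagonal shape operator\<close>

text \<open>Since \<open>mean_curvature\<close> is a definite description, exhibiting
  \<open>l\<close> and \<open>m\<close> is not enough: every other pair of independent eigenvectors
  must give the same sum, which holds because the eigenvalues of a diagonal matrix are its
  entries.\<close>

lemma mean_curvature_diagonal:
  assumes X: "(X has_derivative A) (at p)" "inj A"
    and N: "(gauss_map X has_derivative B) (at p)"
    and s: "- B (1, 0) = l *\<^sub>R A (1, 0)" and t: "- B (0, 1) = m *\<^sub>R A (0, 1)"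
  shows "mean_curvature X p = (l + m) / 2"
proof -
  interpret A: linear A by (rule has_derivative_linear[OF X(1)])
  interpret B: linear B by (rule has_derivative_linear[OF N])
  have fr: "frechet_derivative X (at p) = A" "frechet_derivative (gauss_map X) (at p) = B"
    using frechet_derivative_at X(1) N by metis+
  have "- B (x, y) = A (l * x, m * y)" for x y
  proof -
    have xy: "(x, y) = x *\<^sub>R (1, 0) + y *\<^sub>R (0, 1)" for x y :: real by simp
    have "- B (x, y) = x *\<^sub>R (- B (1, 0)) + y *\<^sub>R (- B (0, 1))"
      by (subst xy) (simp only: B.add B.scale, simp)
    also have "\<dots> = (l * x) *\<^sub>R A (1, 0) + (m * y) *\<^sub>R A (0, 1)"
      unfolding s t by (simp add: mult.commute)
    also have "\<dots> = A (l * x, m * y)"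
      by (subst xy[of "l * x"]) (simp only: A.add A.scale)
    finally show ?thesis .
  qed
  \<comment> \<open>Injectivity of \<open>A\<close> pulls the eigenvector equation back from space
    to the parameter plane, where the matrix is diagonal.\<close>
  hence eig: "- B v = k *\<^sub>R A v \<longleftrightarrow> l * fst v = k * fst v \<and> m * snd v = k * snd v" for v k
    by (cases v) (simp add: A.scale[symmetric] inj_eq[OF X(2)])
  show ?thesis
    unfolding mean_curvature_def principal_curvatures_def fr eig
  proof (rule the_equality)
    have "independent {(1, 0), (0, 1) :: real \<times> real}"
      by (subst independent_insert) (auto simp: span_singleton zero_prod_def)
    thus "\<exists>k1 k2. (\<exists>v w. v \<noteq> w \<and> independent {v, w} \<and>
        (l * fst v = k1 * fst v \<and> m * snd v = k1 * snd v) \<and>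
        l * fst w = k2 * fst w \<and> m * snd w = k2 * snd w) \<and> (l + m) / 2 = (k1 + k2) / 2"
      by (intro exI[of _ l] exI[of _ m] conjI exI[of _ "(1, 0)"] exI[of _ "(0, 1)"]) auto
  next
    fix H
    assume "\<exists>k1 k2. (\<exists>v w. v \<noteq> w \<and> independent {v, w} \<and>
        (l * fst v = k1 * fst v \<and> m * snd v = k1 * snd v) \<and>
        l * fst w = k2 * fst w \<and> m * snd w = k2 * snd w) \<and> H = (k1 + k2) / 2"
    then obtain k1 k2 v w where vw: "v \<noteq> w" "independent {v, w}"
      and e: "l * fst v = k1 * fst v" "m * snd v = k1 * snd v"
        "l * fst w = k2 * fst w" "m * snd w = k2 * snd w" and H: "H = (k1 + k2) / 2"
      by blast
    \<comment> \<open>This is the determinant of \<open>v\<close> and \<open>w\<close>; if it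
      vanished, \<open>v\<close> would be a multiple of \<open>w\<close>.\<close>
    have "fst v * snd w - snd v * fst w \<noteq> 0"
    proof
      assume det: "fst v * snd w - snd v * fst w = 0"
      have "w \<noteq> 0" using vw(2) dependent_zero by blast
      have "v \<in> span {w}"
      proof (cases "fst w = 0")
        case True
        with \<open>w \<noteq> 0\<close> have "snd w \<noteq> 0" by (metis prod.collapse zero_prod_def)
        with True det have "v = (snd v / snd w) *\<^sub>R w" by (simp add: prod_eq_iff)
        thus ?thesis by (auto simp: span_singleton)
      next
        case False
        with det have "v = (fst v / fst w) *\<^sub>R w" by (simp add: prod_eq_iff field_simps)
        thus ?thesis by (auto simp: span_singleton)
      qed
      thus False using vw by (simp add: independent_insert)
    qed
    \<comment> \<open>A nonzero first product forces \<open>k1 = l\<close> and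
      \<open>k2 = m\<close>; a nonzero second one forces the opposite matching. The sum is the
      same.\<close>
    hence "fst v * snd w \<noteq> 0 \<or> snd v * fst w \<noteq> 0" by auto
    hence "k1 + k2 = l + m" using e by auto
    thus "H = (l + m) / 2" using H by simp
  qed
qed

section \<open>Signs, regularity and the unit-speed relation of the profile\<close>

text \<open>Intermediate values: the image is connected and misses 0. The lemma fixes both the side
  of the axis on which the profile lies and the direction of rotation of a loxodrome.\<close>

lemma sgn_constant_on_connected:
  fixes f :: "real \<Rightarrow> real"
  assumes "connected S" "continuous_on S f" "\<And>x. x \<in> S \<Longrightarrow> f x \<noteq> 0"
  obtains \<sigma> :: real where "\<sigma> \<in> {1, -1}" "\<And>x. x \<in> S \<Longrightarrow> sgn (f x) = \<sigma>"
proof -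
  have conn: "connected (f ` S)" by (rule connected_continuous_image[OF assms(2,1)])
  have "\<not> (f x < 0 \<and> f y > 0)" if "x \<in> S" "y \<in> S" for x y
  proof
    assume "f x < 0 \<and> f y > 0"
    hence "0 \<in> f ` S"
      using connectedD_interval[OF conn, of "f x" "f y" 0] that by auto
    thus False using assms(3) by auto
  qed
  hence "(\<forall>x\<in>S. f x > 0) \<or> (\<forall>x\<in>S. f x < 0)"
    using assms(3) by (metis linorder_neqE_linordered_idom)
  thus ?thesis using that[of 1] that[of "-1"] by auto
qed

lemma C1_imp_DERIV:
  fixes f :: "real \<Rightarrow> real"
  assumes "f C1_differentiable_on I" "s \<in> I"
  shows "(f has_real_derivative deriv f s) (at s)"
  using assms unfolding C1_differentiable_on_def
  by (metis DERIV_imp_deriv has_real_derivative_iff_has_vector_derivative)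

lemma rotational_surfaceD:
  assumes "rotational_surface I f g" "s \<in> I"
  shows "(f has_real_derivative deriv f s) (at s)"
    and "(deriv f has_real_derivative deriv (deriv f) s) (at s)"
    and "(g has_real_derivative deriv g s) (at s)"
    and "(deriv g has_real_derivative deriv (deriv g) s) (at s)"
    and "(deriv f s)\<^sup>2 + (deriv g s)\<^sup>2 = 1"
    and "f s \<noteq> 0"
proof -
  show f: "(f has_real_derivative deriv f s) (at s)"
    and "(deriv f has_real_derivative deriv (deriv f) s) (at s)"
    and g: "(g has_real_derivative deriv g s) (at s)"
    and "(deriv g has_real_derivative deriv (deriv g) s) (at s)"
    and "(deriv f s)\<^sup>2 + (deriv g s)\<^sup>2 = 1"
    using assms C1_imp_DERIV by (auto simp: rotational_surface_def)
  show "f s \<noteq> 0"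
    using assms immersion_rot_nonzero[OF _ _ f g] by (auto simp: rotational_surface_def)
qed

lemma rotational_surface_sgn:
  assumes "rotational_surface I f g"
  obtains \<sigma> :: real where "\<sigma> \<in> {1, -1}" "\<And>s. s \<in> I \<Longrightarrow> sgn (f s) = \<sigma>"
proof (rule sgn_constant_on_connected[of I f])
  show "connected I"
    using assms by (simp add: rotational_surface_def is_interval_connected)
  show "continuous_on I f"
    by (meson DERIV_continuous_on has_field_derivative_at_within rotational_surfaceD(1)[OF assms])
qed (use rotational_surfaceD[OF assms] that in auto)

text \<open>Differentiation of \<open>f'\<^sup>2 + g'\<^sup>2 = 1\<close>, which holds near
  \<open>s\<close> because \<open>I\<close> is open.\<close>

lemma rotational_surface_orth:
  assumes R: "rotational_surface I f g" and s: "s \<in> I"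
  shows "deriv f s * deriv (deriv f) s = - (deriv g s * deriv (deriv g) s)"
proof -
  note D = rotational_surfaceD[OF R]
  have "2 * deriv f s * deriv (deriv f) s + 2 * deriv g s * deriv (deriv g) s = 0"
  proof (rule DERIV_unique)
    show "((\<lambda>u. (deriv f u)\<^sup>2 + (deriv g u)\<^sup>2) has_real_derivative
        2 * deriv f s * deriv (deriv f) s + 2 * deriv g s * deriv (deriv g) s) (at s)"
      by (auto intro!: derivative_eq_intros D s)
    show "((\<lambda>u. (deriv f u)\<^sup>2 + (deriv g u)\<^sup>2) has_real_derivative 0) (at s)"
      by (rule has_field_derivative_transform_within_open[OF DERIV_const[of 1]])
        (use R s D(5) in \<open>auto simp: rotational_surface_def\<close>)
  qed
  thus ?thesis by simp
qed

section \<open>Gauss map and mean curvature of a rotational surface\<close>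

text \<open>The cross product of the coordinate vectors is \<open>f s\<close> times a unit vector,
  so normalizing leaves only the sign of \<open>f s\<close>.\<close>

lemma gauss_map_rot:
  assumes "(f has_real_derivative f') (at s)" "(g has_real_derivative g') (at s)"
    and "f'\<^sup>2 + g'\<^sup>2 = 1"
  shows "gauss_map (rot f g) (s, \<theta>) = sgn (f s) *\<^sub>R vector [- g' * cos \<theta>, - g' * sin \<theta>, f']"
    (is "_ = _ *\<^sub>R ?N")
proof -
  have "(g' * cos \<theta>)\<^sup>2 + (g' * sin \<theta>)\<^sup>2 = g'\<^sup>2 * ((sin \<theta>)\<^sup>2 + (cos \<theta>)\<^sup>2)"
    by (simp only: power_mult_distrib algebra_simps)
  also have "\<dots> = g'\<^sup>2" by simp
  finally have norm: "norm ?N = 1"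
    using assms(3) by (simp add: norm_eq_1 inner_vec_def sum_3 power2_eq_square)
  have "f s * f' * (cos \<theta>)\<^sup>2 + f s * f' * (sin \<theta>)\<^sup>2 = f s * f' * ((sin \<theta>)\<^sup>2 + (cos \<theta>)\<^sup>2)"
    by (simp only: algebra_simps)
  hence "cross3 (vector [f' * cos \<theta>, f' * sin \<theta>, g']) (vector [- f s * sin \<theta>, f s * cos \<theta>, 0])
      = f s *\<^sub>R ?N"
    by (simp add: cross3_simps forall_3 power2_eq_square)
  thus ?thesis
    using norm unfolding gauss_map_def frechet_derivative_at[OF has_derivative_rot[OF assms(1,2)], symmetric]
    by (simp add: sgn_scaleR) (simp add: sgn_div_norm)
qed

text \<open>As \<open>sgn (f s)\<close> is constant on \<open>I\<close>, the Gauss map is a constant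
  sign times a rotational map and can be differentiated by the same formula as the surface.
  Meridians and parallels turn out to be the principal directions.\<close>

lemma mean_curvature_rot:
  assumes R: "rotational_surface I f g" and s: "s \<in> I"
  shows "mean_curvature (rot f g) (s, \<theta>) =
    sgn (f s) * (deriv f s * deriv (deriv g) s - deriv g s * deriv (deriv f) s + deriv g s / f s) / 2"
proof -
  note D = rotational_surfaceD[OF R]
  obtain \<sigma> :: real where \<sigma>: "\<And>u. u \<in> I \<Longrightarrow> sgn (f u) = \<sigma>" using rotational_surface_sgn[OF R] by metis
  let ?A = "\<lambda>(h, k). vector [deriv f s * h * cos \<theta> - f s * sin \<theta> * k,
    deriv f s * h * sin \<theta> + f s * cos \<theta> * k, deriv g s * h] :: real^3"
  let ?B = "\<lambda>(h, k). vector [- deriv (deriv g) s * h * cos \<theta> - (- deriv g s) * sin \<theta> * k,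
    - deriv (deriv g) s * h * sin \<theta> + (- deriv g s) * cos \<theta> * k, deriv (deriv f) s * h] :: real^3"
  \<comment> \<open>Up to sign, \<open>?l\<close> is the curvature of the profile curve and
    \<open>?m\<close> the principal curvature along the parallel.\<close>
  let ?l = "\<sigma> * (deriv f s * deriv (deriv g) s - deriv g s * deriv (deriv f) s)"
  let ?m = "\<sigma> * (deriv g s / f s)"
  have X: "(rot f g has_derivative ?A) (at (s, \<theta>))"
    by (rule has_derivative_rot[OF D(1,3)[OF s]])
  have N: "(gauss_map (rot f g) has_derivative (\<lambda>h. \<sigma> *\<^sub>R ?B h)) (at (s, \<theta>))"
  proof (rule has_derivative_transform_within_open)
    show "((\<lambda>p. \<sigma> *\<^sub>R rot (\<lambda>u. - deriv g u) (deriv f) p) has_derivative (\<lambda>h. \<sigma> *\<^sub>R ?B h)) (at (s, \<theta>))"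
      by (intro has_derivative_scaleR_right has_derivative_rot DERIV_minus D s)
    show "open (I \<times> (UNIV :: real set))"
      using R by (simp add: rotational_surface_def open_Times)
    show "\<sigma> *\<^sub>R rot (\<lambda>u. - deriv g u) (deriv f) p = gauss_map (rot f g) p"
      if "p \<in> I \<times> UNIV" for p
      using that gauss_map_rot[OF D(1,3,5)] \<sigma> by (auto simp: rot_def)
  qed (use s in simp)
  \<comment> \<open>Frenet equations of the unit-speed profile: \<open>(f'', g'')\<close> is
    orthogonal to \<open>(f', g')\<close>, hence the signed curvature times
    \<open>(- g', f')\<close>.\<close>
  have g2: "deriv (deriv g) s = (deriv f s * deriv (deriv g) s - deriv g s * deriv (deriv f) s) * deriv f s"
    and f2: "- deriv (deriv f) s = (deriv f s * deriv (deriv g) s - deriv g s * deriv (deriv f) s) * deriv g s"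
    using rotational_surface_orth[OF R s] D(5)[OF s] by algebra+
  obtain A' where "(rot f g has_derivative A') (at (s, \<theta>))" "inj A'"
    using R s unfolding rotational_surface_def immersion_on_def by blast
  hence inj: "inj ?A" using has_derivative_unique[OF X] by blast
  have "mean_curvature (rot f g) (s, \<theta>) = (?l + ?m) / 2"
  proof (rule mean_curvature_diagonal[OF X inj N])
    show "- (\<sigma> *\<^sub>R ?B (1, 0)) = ?l *\<^sub>R ?A (1, 0)"
      using arg_cong[OF g2, of "\<lambda>x. \<sigma> * x * cos \<theta>"] arg_cong[OF g2, of "\<lambda>x. \<sigma> * x * sin \<theta>"]
        arg_cong[OF f2, of "\<lambda>x. \<sigma> * x"]
      by (simp add: vec_eq_iff forall_3 mult.assoc)
    show "- (\<sigma> *\<^sub>R ?B (0, 1)) = ?m *\<^sub>R ?A (0, 1)"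
      using D(6)[OF s] by (simp add: vec_eq_iff forall_3)
  qed
  thus ?thesis using \<sigma>[OF s] by (simp add: algebra_simps)
qed

section \<open>Integration of the minimal surface equation\<close>

text \<open>Used with slope 1 for the height of the profile and with slope \<open>cos \<psi>\<close>
  for the longitude along a loxodrome.\<close>

lemma DERIV_arsinh_affine:
  "((\<lambda>t. k * arsinh (n * (a * t + b))) has_real_derivative
    k * (n * a / sqrt (1 + n\<^sup>2 * (a * t + b)\<^sup>2))) (at t)"
proof -
  have "((\<lambda>t. n * (a * t + b)) has_real_derivative n * a) (at t)"
    by (auto intro!: derivative_eq_intros)
  from DERIV_cmult[OF DERIV_chain2[OF arsinh_real_has_field_derivative this], of k]
  show ?thesis by (simp add: power_mult_distrib add.commute)
qed

text \<open>Solves for the catenary from the first integrals \<open>f g'\<close> and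
  \<open>f f' - s\<close>. The sign \<open>\<sigma>\<close> records the side of the axis,
  \<open>\<epsilon>\<close> whether the height increases or decreases.\<close>

lemma minimal_profile:
  assumes R: "rotational_surface I f g" and min: "minimal_on (rot f g) (I \<times> UNIV)"
    and nc: "\<not> g constant_on I"
  obtains m \<sigma> \<epsilon> b r :: real where "m > 0" "\<sigma> \<in> {1, -1}" "\<epsilon> \<in> {1, -1}"
    and "\<And>s. s \<in> I \<Longrightarrow> sgn (deriv g s) = \<epsilon>"
    and "\<And>s. s \<in> I \<Longrightarrow> f s = \<sigma> / m * sqrt (1 + m\<^sup>2 * (s + b)\<^sup>2)"
    and "\<And>s. s \<in> I \<Longrightarrow> g s = \<epsilon> / m * arsinh (m * (s + b)) + r"
proof -
  note D = rotational_surfaceD[OF R]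
  have conv: "convex I"
    using R by (simp add: rotational_surface_def is_interval_convex)
  have const: "\<exists>c. \<forall>s\<in>I. h s = c" if "\<And>s. s \<in> I \<Longrightarrow> (h has_real_derivative 0) (at s)"
    for h :: "real \<Rightarrow> real"
    using has_field_derivative_zero_constant[OF conv] that has_field_derivative_at_within
    by metis
  have ode: "f s * (deriv f s * deriv (deriv g) s - deriv g s * deriv (deriv f) s) + deriv g s = 0"
    if s: "s \<in> I" for s
  proof -
    have "mean_curvature (rot f g) (s, 0) = 0"
      using min s by (auto simp: minimal_on_def)
    hence "deriv f s * deriv (deriv g) s - deriv g s * deriv (deriv f) s + deriv g s / f s = 0"
      using D(6)[OF s] unfolding mean_curvature_rot[OF R s] by (simp add: sgn_0_0)
    thus ?thesis using D(6)[OF s] by (simp add: field_simps)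
  qed
  have fg': "((\<lambda>s. f s * deriv g s) has_real_derivative 0) (at s)"
    and ff': "((\<lambda>s. f s * deriv f s - s) has_real_derivative 0) (at s)" if s: "s \<in> I" for s
  proof -
    \<comment> \<open>Multiply \<open>ode\<close> by \<open>f'\<close> for the first equation and by
      \<open>g'\<close> for the second, then eliminate with the unit-speed relation and its
      derivative.\<close>
    have "deriv f s * deriv g s + f s * deriv (deriv g) s = 0"
      and "(deriv f s)\<^sup>2 + f s * deriv (deriv f) s = 1"
      using ode[OF s] rotational_surface_orth[OF R s] D(5)[OF s] by algebra+
    thus "((\<lambda>s. f s * deriv g s) has_real_derivative 0) (at s)"
      and "((\<lambda>s. f s * deriv f s - s) has_real_derivative 0) (at s)"
      by (auto intro!: derivative_eq_intros D[OF s] simp: power2_eq_square algebra_simps)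
  qed
  obtain c where c: "\<And>s. s \<in> I \<Longrightarrow> f s * deriv g s = c" using const[OF fg'] by blast
  obtain b where b: "\<And>s. s \<in> I \<Longrightarrow> f s * deriv f s - s = b" using const[OF ff'] by blast
  have "c \<noteq> 0"
  proof
    assume "c = 0"
    hence "deriv g s = 0" if "s \<in> I" for s using c D(6) that by force
    hence "\<exists>r. \<forall>s\<in>I. g s = r" using const[of g] D(3) by force
    thus False using nc by (simp add: constant_on_def)
  qed
  \<comment> \<open>\<open>\<bar>c\<bar>\<close> is the waist radius of the catenoid.\<close>
  define m where "m = 1 / \<bar>c\<bar>"
  have m: "m > 0" using \<open>c \<noteq> 0\<close> by (simp add: m_def)
  obtain \<sigma> :: real where \<sigma>: "\<sigma> \<in> {1, -1}" "\<And>s. s \<in> I \<Longrightarrow> sgn (f s) = \<sigma>"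
    using rotational_surface_sgn[OF R] by metis
  \<comment> \<open>Forced by \<open>c = f g'\<close>, whose sign is \<open>\<sigma>\<close> times
    that of \<open>g'\<close>.\<close>
  define \<epsilon> where "\<epsilon> = sgn c * \<sigma>"
  have \<epsilon>: "\<epsilon> \<in> {1, -1}" using \<sigma>(1) \<open>c \<noteq> 0\<close> by (auto simp: \<epsilon>_def sgn_if)
  have sgn_g: "sgn (deriv g s) = \<epsilon>" if s: "s \<in> I" for s
  proof -
    have "sgn c = \<sigma> * sgn (deriv g s)"
      unfolding c[OF s, symmetric] sgn_mult \<sigma>(2)[OF s] ..
    thus ?thesis using \<sigma>(1) by (auto simp: \<epsilon>_def)
  qed
  have root: "sqrt (1 + m\<^sup>2 * (s + b)\<^sup>2) = m * \<bar>f s\<bar>" if s: "s \<in> I" for s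
  proof (rule real_sqrt_unique)
    \<comment> \<open>Sum of the squares of \<open>f g' = c\<close> and
      \<open>f f' = s + b\<close>.\<close>
    have "(f s)\<^sup>2 = c\<^sup>2 + (s + b)\<^sup>2"
      using D(5)[OF s] b[OF s] c[OF s] by algebra
    thus "(m * \<bar>f s\<bar>)\<^sup>2 = 1 + m\<^sup>2 * (s + b)\<^sup>2"
      using \<open>c \<noteq> 0\<close> by (simp add: m_def power_mult_distrib power_divide field_simps)
  qed (use m in simp)
  have "((\<lambda>s. g s - \<epsilon> / m * arsinh (m * (s + b))) has_real_derivative 0) (at s)" if s: "s \<in> I" for s
  proof -
    have "deriv g s = \<epsilon> * \<bar>deriv g s\<bar>" using sgn_g[OF s] by (metis mult_sgn_abs)
    also have "\<bar>deriv g s\<bar> = 1 / (m * \<bar>f s\<bar>)"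
      using c[OF s] D(6)[OF s] by (auto simp: m_def abs_mult)
    finally have "deriv g s = \<epsilon> / m * (m / sqrt (1 + m\<^sup>2 * (s + b)\<^sup>2))"
      using m root[OF s] by simp
    thus ?thesis
      using DERIV_diff[OF D(3)[OF s] DERIV_arsinh_affine[of "\<epsilon> / m" m 1 b s]] by simp
  qed
  then obtain r where r: "\<And>s. s \<in> I \<Longrightarrow> g s - \<epsilon> / m * arsinh (m * (s + b)) = r"
    using const[of "\<lambda>s. g s - \<epsilon> / m * arsinh (m * (s + b))"] by blast
  show ?thesis
  proof (rule that[OF m \<sigma>(1) \<epsilon> sgn_g])
    show "f s = \<sigma> / m * sqrt (1 + m\<^sup>2 * (s + b)\<^sup>2)" if "s \<in> I" for s
      using m by (simp add: root[OF that] \<sigma>(2)[OF that, symmetric] sgn_mult_abs)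
    show "g s = \<epsilon> / m * arsinh (m * (s + b)) + r" if "s \<in> I" for s
      using r[OF that] by simp
  qed
qed

section \<open>Differential equations of a loxodrome\<close>

lemma has_vector_derivative_rot_curve:
  assumes f: "(f has_real_derivative f') (at (s t))" and g: "(g has_real_derivative g') (at (s t))"
    and s: "(s has_real_derivative s') (at t)" and \<theta>: "(\<theta> has_real_derivative \<theta>') (at t)"
  shows "((\<lambda>t. rot f g (s t, \<theta> t)) has_vector_derivative
    vector [f' * s' * cos (\<theta> t) - f (s t) * sin (\<theta> t) * \<theta>',
      f' * s' * sin (\<theta> t) + f (s t) * cos (\<theta> t) * \<theta>', g' * s']) (at t)"
proof -
  have "((\<lambda>t. (s t, \<theta> t)) has_derivative (\<lambda>h. (s' * h, \<theta>' * h))) (at t)"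
    using s \<theta> by (auto intro!: has_derivative_Pair simp: has_field_derivative_def)
  from has_derivative_compose[OF this has_derivative_rot[OF f g]]
  show ?thesis
    unfolding has_vector_derivative_def
    by (rule has_derivative_eq_rhs) (auto simp: fun_eq_iff vec_eq_iff forall_3 algebra_simps)
qed

text \<open>In the orthonormal frame of meridian and parallel directions the velocity has components
  \<open>s'\<close> and \<open>f \<theta>'\<close>. The angle determines the first, and unit speed
  the square of the second.\<close>

lemma loxodrome_ode:
  assumes R: "rotational_surface I f g" and L: "loxodrome I f g \<psi> J \<alpha>"
  obtains s \<theta> \<eta> where "\<eta> \<in> {1, -1 :: real}"
    and "\<And>t. t \<in> J \<Longrightarrow> s t \<in> I \<and> \<alpha> t = rot f g (s t, \<theta> t)"
    and "\<And>t. t \<in> J \<Longrightarrow> (s has_real_derivative cos \<psi>) (at t)"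
    and "\<And>t. t \<in> J \<Longrightarrow> (\<theta> has_real_derivative \<eta> * sin \<psi> / f (s t)) (at t)"
proof -
  note D = rotational_surfaceD[OF R]
  from L obtain s \<theta> where \<psi>: "0 \<le> \<psi>" "\<psi> \<le> pi" and J: "open J" "is_interval J"
    and C1: "s C1_differentiable_on J" "\<theta> C1_differentiable_on J"
    and sI: "\<And>t. t \<in> J \<Longrightarrow> s t \<in> I \<and> \<alpha> t = rot f g (s t, \<theta> t)"
    and unit: "\<And>t. t \<in> J \<Longrightarrow> norm (vector_derivative \<alpha> (at t)) = 1"
    and angle: "\<And>t. t \<in> J \<Longrightarrow> vec_angle (vector_derivative \<alpha> (at t))
                     (vector_derivative (\<lambda>u. rot f g (u, \<theta> t)) (at (s t))) = \<psi>"
    unfolding loxodrome_def by blast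
  have ds: "(s has_real_derivative deriv s t) (at t)"
    and d\<theta>: "(\<theta> has_real_derivative deriv \<theta> t) (at t)" if "t \<in> J" for t
    using C1_imp_DERIV C1 that by auto
  have s': "deriv s t = cos \<psi>" and \<theta>': "(f (s t) * deriv \<theta> t)\<^sup>2 = (sin \<psi>)\<^sup>2" if t: "t \<in> J" for t
  proof -
    have st: "s t \<in> I" using sI t by blast
    let ?V = "vector [deriv f (s t) * deriv s t * cos (\<theta> t) - f (s t) * sin (\<theta> t) * deriv \<theta> t,
      deriv f (s t) * deriv s t * sin (\<theta> t) + f (s t) * cos (\<theta> t) * deriv \<theta> t,
      deriv g (s t) * deriv s t] :: real^3"
    let ?M = "vector [deriv f (s t) * cos (\<theta> t), deriv f (s t) * sin (\<theta> t), deriv g (s t)] :: real^3"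
    have "(\<alpha> has_vector_derivative ?V) (at t)"
      by (rule has_vector_derivative_transform_within_open
          [OF has_vector_derivative_rot_curve[OF D(1,3)[OF st] ds[OF t] d\<theta>[OF t]] J(1) t])
        (use sI in simp)
    hence V: "vector_derivative \<alpha> (at t) = ?V" by (rule vector_derivative_at)
    \<comment> \<open>A meridian is the special curve with \<open>s\<close> the identity and
      constant longitude.\<close>
    have M: "vector_derivative (\<lambda>u. rot f g (u, \<theta> t)) (at (s t)) = ?M"
      using has_vector_derivative_rot_curve[of f "deriv f (s t)" "\<lambda>u. u" "s t" g "deriv g (s t)" 1
          "\<lambda>_. \<theta> t" 0] D(1,3)[OF st]
      by (intro vector_derivative_at) simp
    have "?M \<bullet> ?M = ((deriv f (s t))\<^sup>2 + (deriv g (s t))\<^sup>2)"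
      unfolding inner_vec_def sum_3 vector_3 inner_real_def
      using sin_cos_squared_add[of "\<theta> t"] by algebra
    hence nM: "norm ?M = 1" using D(5)[OF st] by (simp add: norm_eq_1)
    have "?V \<bullet> ?M = deriv s t * ((deriv f (s t))\<^sup>2 + (deriv g (s t))\<^sup>2)"
      unfolding inner_vec_def sum_3 vector_3 inner_real_def
      using sin_cos_squared_add[of "\<theta> t"] by algebra
    hence VM: "?V \<bullet> ?M = deriv s t" using D(5)[OF st] by simp
    have nV: "norm ?V = 1" using unit[OF t] V by simp
    have "?V \<bullet> ?V = (deriv s t)\<^sup>2 * ((deriv f (s t))\<^sup>2 + (deriv g (s t))\<^sup>2) + (f (s t) * deriv \<theta> t)\<^sup>2"
      unfolding inner_vec_def sum_3 vector_3 inner_real_def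
      using sin_cos_squared_add[of "\<theta> t"] by algebra
    hence VV: "(deriv s t)\<^sup>2 + (f (s t) * deriv \<theta> t)\<^sup>2 = 1"
      using D(5)[OF st] nV by (simp add: norm_eq_1)
    \<comment> \<open>The bound is needed to invert \<open>arccos\<close>.\<close>
    have "\<bar>deriv s t\<bar> \<le> 1" using Cauchy_Schwarz_ineq2[of ?V ?M] VM nV nM by simp
    moreover have "arccos (deriv s t) = \<psi>"
      using angle[OF t] unfolding V M vec_angle_def VM nV nM by simp
    ultimately show s': "deriv s t = cos \<psi>" using cos_arccos_abs by metis
    show "(f (s t) * deriv \<theta> t)\<^sup>2 = (sin \<psi>)\<^sup>2"
      using VV sin_cos_squared_add[of \<psi>] unfolding s' by linarith
  qed
  have sin: "sin \<psi> \<ge> 0" using \<psi> by (rule sin_ge_zero)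
  have "\<exists>\<eta>\<in>{1, -1}. \<forall>t\<in>J. f (s t) * deriv \<theta> t = \<eta> * sin \<psi>"
  \<comment> \<open>If \<open>sin \<psi> = 0\<close> then \<open>f \<theta>'\<close> vanishes and
    either sign serves; otherwise \<open>f \<theta>'\<close> has no zero and keeps its sign on the
    interval \<open>J\<close>.\<close>
  proof (cases "sin \<psi> = 0")
    case True
    thus ?thesis using \<theta>' by fastforce
  next
    case False
    \<comment> \<open>Here the curve must be of class C1: mere differentiability of
      \<open>\<theta>\<close> would not give a continuous derivative.\<close>
    have "continuous_on J (deriv \<theta>)"
      using C1(2) d\<theta> unfolding C1_differentiable_on_def
      by (metis (no_types, lifting) continuous_on_cong DERIV_imp_deriv
          has_real_derivative_iff_has_vector_derivative)
    moreover have "continuous_on J (\<lambda>t. f (s t))"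
      by (rule DERIV_continuous_on[OF has_field_derivative_at_within
            [OF DERIV_chain2[OF D(1) ds]]]) (use sI in auto)
    ultimately have cont: "continuous_on J (\<lambda>t. f (s t) * deriv \<theta> t)"
      by (intro continuous_intros)
    have "f (s t) * deriv \<theta> t \<noteq> 0" if "t \<in> J" for t
      using \<theta>'[OF that] False by force
    then obtain \<eta> :: real where \<eta>: "\<eta> \<in> {1, -1}" "\<And>t. t \<in> J \<Longrightarrow> sgn (f (s t) * deriv \<theta> t) = \<eta>"
      using sgn_constant_on_connected[OF is_interval_connected[OF J(2)] cont] by metis
    have "f (s t) * deriv \<theta> t = \<eta> * sin \<psi>" if t: "t \<in> J" for t
    proof -
      have "\<bar>f (s t) * deriv \<theta> t\<bar> = sin \<psi>"
        using \<theta>'[OF t] sin by (metis power2_eq_iff_nonneg abs_ge_zero power2_abs)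
      thus ?thesis using \<eta>(2)[OF t] by (metis sgn_mult_abs)
    qed
    thus ?thesis using \<eta>(1) by blast
  qed
  then obtain \<eta> where \<eta>: "\<eta> \<in> {1, -1}" "\<And>t. t \<in> J \<Longrightarrow> f (s t) * deriv \<theta> t = \<eta> * sin \<psi>" by blast
  have "\<eta> * sin \<psi> / f (s t) = deriv \<theta> t" if t: "t \<in> J" for t
    using \<eta>(2)[OF t] D(6)[of "s t"] sI[OF t] by (simp add: field_simps)
  thus ?thesis using that[OF \<eta>(1) sI] ds d\<theta> s' by auto
qed

section \<open>Explicit form of the loxodromes\<close>

text \<open>The factor \<open>\<epsilon>\<close> covers profiles traversed downwards:
  \<open>1 / n * arsinh (n * x)\<close> is even in \<open>n\<close> and increasing in
  \<open>x\<close>, so the sign of \<open>n\<close> cannot absorb it. \<open>not_planar\<close>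
  leaves only catenoids. At \<open>\<psi> = pi / 2\<close> the loxodrome is a parallel, and
  \<open>tan \<psi>\<close> would divide by zero.\<close>

theorem theorem8:
  fixes I J :: "real set" and f g :: "real \<Rightarrow> real"
    and \<psi> :: real and \<alpha> :: "real \<Rightarrow> real^3"
  assumes "rotational_surface I f g"
    and "minimal_on (rot f g) (I \<times> UNIV)"
    and not_planar: "\<not> g constant_on I"
    and "loxodrome I f g \<psi> J \<alpha>"
    and tan_defined: "\<psi> \<noteq> pi / 2"
    and a: "a = cos \<psi>"
  shows "\<exists>n p q r \<epsilon> :: real. n \<noteq> 0 \<and> \<epsilon> \<in> {1, -1} \<and>
    (\<forall>u\<in>I. sgn (deriv g u) = \<epsilon>) \<and>
    (\<forall>t\<in>J. \<alpha> t = vector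
      [1 / n * sqrt (1 + n\<^sup>2 * (a * t + p)\<^sup>2) * cos (tan \<psi> * arsinh (n * (a * t + p)) + q),
       1 / n * sqrt (1 + n\<^sup>2 * (a * t + p)\<^sup>2) * sin (tan \<psi> * arsinh (n * (a * t + p)) + q),
       \<epsilon> * (1 / n * arsinh (n * (a * t + p))) + r])"
proof -
  obtain m \<sigma> \<epsilon> b r :: real where m: "m > 0" and \<sigma>: "\<sigma> \<in> {1, -1}" and \<epsilon>: "\<epsilon> \<in> {1, -1}"
    and sgn_g: "\<And>s. s \<in> I \<Longrightarrow> sgn (deriv g s) = \<epsilon>"
    and f: "\<And>s. s \<in> I \<Longrightarrow> f s = \<sigma> / m * sqrt (1 + m\<^sup>2 * (s + b)\<^sup>2)"
    and g: "\<And>s. s \<in> I \<Longrightarrow> g s = \<epsilon> / m * arsinh (m * (s + b)) + r"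
    using minimal_profile[OF assms(1-3)] by metis
  obtain s \<theta> and \<eta> :: real where \<eta>: "\<eta> \<in> {1, -1}"
    and \<alpha>: "\<And>t. t \<in> J \<Longrightarrow> s t \<in> I \<and> \<alpha> t = rot f g (s t, \<theta> t)"
    and ds: "\<And>t. t \<in> J \<Longrightarrow> (s has_real_derivative a) (at t)"
    and d\<theta>: "\<And>t. t \<in> J \<Longrightarrow> (\<theta> has_real_derivative \<eta> * sin \<psi> / f (s t)) (at t)"
    using loxodrome_ode[OF assms(1,4)] unfolding a by metis
  have \<psi>: "0 \<le> \<psi>" "\<psi> \<le> pi" and conv: "convex J"
    using assms(4) by (auto simp: loxodrome_def is_interval_convex)
  have const: "\<exists>c. \<forall>t\<in>J. h t = c" if "\<And>t. t \<in> J \<Longrightarrow> (h has_real_derivative 0) (at t)"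
    for h :: "real \<Rightarrow> real"
    using has_field_derivative_zero_constant[OF conv] that has_field_derivative_at_within
    by metis
  have "cos \<psi> \<noteq> 0"
    using cos_inj_pi[OF \<psi>, of "pi / 2"] tan_defined by auto
  hence tan: "tan \<psi> * a = sin \<psi>" by (simp add: a tan_def)
  have "((\<lambda>t. s t - a * t) has_real_derivative 0) (at t)" if "t \<in> J" for t
    by (auto intro!: derivative_eq_intros ds that)
  then obtain p0 where "\<And>t. t \<in> J \<Longrightarrow> s t - a * t = p0"
    using const[of "\<lambda>t. s t - a * t"] by blast
  hence s: "s t + b = a * t + (p0 + b)" if "t \<in> J" for t using that by (simp add: algebra_simps)
  define p where "p = p0 + b"
  \<comment> \<open>Replacing \<open>n\<close> by \<open>-n\<close> reverses the rotation and is compensated by \<open>q + \<pi>\<close>, so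
    the sign of \<open>n\<close> is free to match the direction of rotation of \<open>\<alpha>\<close>.\<close>
  define n where "n = \<sigma> * \<eta> * m"
  have n: "n \<noteq> 0" using m \<sigma> \<eta> by (auto simp: n_def)
  have n2: "n\<^sup>2 = m\<^sup>2" using \<sigma> \<eta> by (auto simp: n_def)
  \<comment> \<open>By the choice of \<open>n\<close>,
    \<open>\<sigma> / m = \<eta> / n\<close>.\<close>
  have ft: "f (s t) = \<eta> / n * sqrt (1 + n\<^sup>2 * (a * t + p)\<^sup>2)" if t: "t \<in> J" for t
    using f[of "s t"] \<alpha>[OF t] \<eta> \<sigma> unfolding n2 s[OF t] p_def[symmetric] by (auto simp: n_def)
  \<comment> \<open>Evenness of \<open>1 / n * arsinh (n * x)\<close> in \<open>n\<close> lets
    \<open>n\<close> replace \<open>m\<close> in the height.\<close>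
  have gt: "g (s t) = \<epsilon> * (1 / n * arsinh (n * (a * t + p))) + r" if t: "t \<in> J" for t
    using g[of "s t"] \<alpha>[OF t] \<eta> \<sigma> unfolding s[OF t] p_def[symmetric]
    by (auto simp: n_def arsinh_minus_real)
  have "((\<lambda>t. \<theta> t - tan \<psi> * arsinh (n * (a * t + p))) has_real_derivative 0) (at t)"
    if t: "t \<in> J" for t
  proof -
    \<comment> \<open>The sign \<open>\<eta>\<close> of the rotation cancels against the one in
      \<open>ft\<close>.\<close>
    have "\<eta> * sin \<psi> / f (s t) = tan \<psi> * (n * a / sqrt (1 + n\<^sup>2 * (a * t + p)\<^sup>2))"
      using \<eta> n unfolding ft[OF t] tan[symmetric] by auto
    thus ?thesis
      using DERIV_diff[OF d\<theta>[OF t] DERIV_arsinh_affine[of "tan \<psi>" n a p t]] by simp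
  qed
  then obtain q0 where "\<And>t. t \<in> J \<Longrightarrow> \<theta> t - tan \<psi> * arsinh (n * (a * t + p)) = q0"
    using const[of "\<lambda>t. \<theta> t - tan \<psi> * arsinh (n * (a * t + p))"] by blast
  hence \<theta>: "\<theta> t = tan \<psi> * arsinh (n * (a * t + p)) + q0" if "t \<in> J" for t
    using that by (simp add: algebra_simps)
  define q where "q = (if \<eta> = 1 then q0 else q0 + pi)"
  have q: "cos (x + q) = \<eta> * cos (x + q0)" "sin (x + q) = \<eta> * sin (x + q0)" for x
    using \<eta> by (auto simp: q_def add.assoc[symmetric])
  show ?thesis
  proof (rule exI[of _ n], rule exI[of _ p], rule exI[of _ q], rule exI[of _ r], rule exI[of _ \<epsilon>],
      intro conjI ballI)
    show "\<alpha> t = vector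
      [1 / n * sqrt (1 + n\<^sup>2 * (a * t + p)\<^sup>2) * cos (tan \<psi> * arsinh (n * (a * t + p)) + q),
       1 / n * sqrt (1 + n\<^sup>2 * (a * t + p)\<^sup>2) * sin (tan \<psi> * arsinh (n * (a * t + p)) + q),
       \<epsilon> * (1 / n * arsinh (n * (a * t + p))) + r]" if t: "t \<in> J" for t
      using \<alpha>[OF t] by (simp add: rot_def ft[OF t] gt[OF t] \<theta>[OF t] q mult_ac)
  qed (use n \<epsilon> sgn_g in auto)
qed

end
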